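(* Let $k,m\in\mathbb{N}$ with $k\geq2$ and $m\geq1$, and $0<\vartheta<\varepsilon\leq1$. Then there exists a positive integer $\mathrm{Cor}_2(k,m,\vartheta,\varepsilon)$ with the following property. If $W$ is a Carlson--Simpson tree of $[k]^{<\mathbb{N}}$ of dimension at least $\mathrm{Cor}_2(k,m,\vartheta,\varepsilon)$ and $\{A_w:w\in W\}$ is a family of measurable events in a probability space $(\Omega,\Sigma,\mu)$ satisfying $\mu(A_w)\geq\varepsilon$ for every $w\in W$, then there exists a Carlson--Simpson subtree $U$ of $W$ with $\dim(U)=m$ and such that for every $u,u'\in U$ we have \[ \mu(A_u\cap A_{u'})\geq\vartheta^2. \]
   Context: $\mathbb{N}=\{0,1,2,\dots\}$ and $[k]=\{1,\dots,k\}$. A word over $k$ is a finite (possibly empty) sequence with values in $[k]$; $[k]^{<\mathbb{N}}$ is the set of all words over $k$; concatenation is denoted $u\circ v$. Fix a letter $x\notin[k]$ (a variable). A left variable word over $k$ is a finite nonempty sequence with values in $[k]\cup\{x\}$ whose first letter is $x$; $w(a)$ is obtained by replacing every occurrence of $x$ in $w$ by $a\in[k]$. A Carlson--Simpson tree of $[k]^{<\mathbb{N}}$ of dimension $m\geq1$ is a set of the form \[ \{w\}\cup\big\{w\circ w_0(a_0)\circ\cdots\circ w_n(a_n): n\in\{0,\dots,m-1\},\ a_0,\dots,a_n\in[k]\big\} \] where $w$ is a word over $k$ and $w_0,\dots,w_{m-1}$ are left variable words over $k$ (uniquely determined by the tree). A Carlson--Simpson subtree of $W$ is a Carlson--Simpson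 tree of $[k]^{<\mathbb{N}}$ contained in $W$; $\dim$ denotes dimension. *)

theory Defs
  imports "HOL-Probability.Probability"
begin

definition words :: "nat \<Rightarrow> nat list set" where
  "words k = {w. set w \<subseteq> {1..k}}"

(* The variable x is None, and a letter a of [k] is Some a. *)
definition left_var_word :: "nat \<Rightarrow> nat option list \<Rightarrow> bool" where
  "left_var_word k v \<longleftrightarrow> v \<noteq> [] \<and> hd v = None \<and> set v \<subseteq> insert None (Some ` {1..k})"

definition subst_var :: "nat option list \<Rightarrow> nat \<Rightarrow> nat list" where
  "subst_var v a = map (\<lambda>c. case c of None \<Rightarrow> a | Some b \<Rightarrow> b) v"

definition cs_set :: "nat \<Rightarrow> nat list \<Rightarrow> nat option list list \<Rightarrow> nat list set" where
  "cs_set k w vs = {w} \<union>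
     {w @ concat (map (\<lambda>i. subst_var (vs ! i) (a i)) [0..<Suc n]) | n a.
        n < length vs \<and> (\<forall>i\<le>n. a i \<in> {1..k})}"

(* T is a Carlson-Simpson tree of dimension m. For k \<ge> 1 the dimension is a function of
   the set T: the number of different lengths of words in T is m + 1. *)
definition cs_tree :: "nat \<Rightarrow> nat \<Rightarrow> nat list set \<Rightarrow> bool" where
  "cs_tree k m T \<longleftrightarrow> 1 \<le> m \<and>
     (\<exists>w vs. w \<in> words k \<and> length vs = m \<and> (\<forall>v\<in>set vs. left_var_word k v) \<and> T = cs_set k w vs)"

(* The least positive threshold that works for all probability spaces on the type nat.
   A number obtained by an existential quantifier in a statement about measures on 'a could
   depend on the type 'a; this constant cannot. That the threshold exists, and that
   it works for probability spaces on every other type as well, is not part of the definition. *)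
definition Cor2 :: "nat \<Rightarrow> nat \<Rightarrow> real \<Rightarrow> real \<Rightarrow> nat" where
  "Cor2 k m \<theta> \<epsilon> = (LEAST N. 0 < N \<and>
     (\<forall>d W (M :: nat measure) A.
        cs_tree k d W \<longrightarrow> N \<le> d \<longrightarrow> prob_space M \<longrightarrow>
        (\<forall>w\<in>W. A w \<in> sets M \<and> measure M (A w) \<ge> \<epsilon>) \<longrightarrow>
        (\<exists>U. cs_tree k m U \<and> U \<subseteq> W \<and>
           (\<forall>u\<in>U. \<forall>u'\<in>U. measure M (A u \<inter> A u') \<ge> \<theta>\<^sup>2))))"

end

theory Submission
  imports Defs
begin

text \<open>
  By the Cauchy-Schwarz inequality, among \<open>N\<close> events of measure at least \<open>\<epsilon>\<close>, with \<open>N\<close> large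
  in terms of \<open>\<epsilon>\<^sup>2 - \<theta>\<^sup>2\<close>, two have an intersection of measure at least \<open>\<theta>\<^sup>2\<close>. So it
  suffices to find, in a graph on words with no independent sequence of length \<open>N\<close>, a
  Carlson-Simpson tree that is a clique. By compactness the graph may live on all words. There is
  an ultrafilter \<open>V\<close> of left variable words with \<open>V \<diamondop> V = V\<close> and \<open>V \<diamondop> V(a) = V\<close> for every letter
  \<open>a\<close>; its left variable words can be merged and prolonged without leaving \<open>V\<close>. If, for a
  \<open>V\<close>-generic tree, the words at the positions \<open>t\<close> and \<open>t'\<close> were not adjacent, then neither would
  be any two words at positions of the form
  \[ t'_1{}^i t_1{}^{N-i} \cdots t'_p{}^i t_p{}^{N-i} (t'_{p+1} \cdots t'_q)^i, \qquad i < N, \]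
  since any two of these play the roles of \<open>t\<close> and \<open>t'\<close> in a suitable subtree. Hence a generic tree
  is a clique.
\<close>

subsection \<open>Ultrafilters of words\<close>

definition ultra :: "'a filter \<Rightarrow> bool" where
  "ultra F \<longleftrightarrow> F \<noteq> bot \<and> (\<forall>P. eventually P F \<or> eventually (\<lambda>x. \<not> P x) F)"

lemma ultra_not_iff:
  assumes "ultra F"
  shows "eventually (\<lambda>x. \<not> P x) F \<longleftrightarrow> \<not> eventually P F"
proof -
  have "\<not> (eventually P F \<and> eventually (\<lambda>x. \<not> P x) F)"
    using assms by (simp add: ultra_def trivial_limit_def flip: eventually_conj_iff)
  then show ?thesis
    using assms by (auto simp: ultra_def)
qed

text \<open>Smaller means finer, so ultrafilters are the atoms: if \<open>F\<close> rejected a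
  property of \<open>G\<close>, then \<open>F\<close> and hence \<open>G\<close> would contain its
  negation.\<close>

lemma ultra_minimal:
  assumes "ultra F" "G \<le> F" "G \<noteq> bot"
  shows "G = F"
proof (rule antisym)
  show "F \<le> G"
  proof (rule filter_leI)
    fix P assume P: "eventually P G"
    show "eventually P F"
    proof (rule ccontr)
      assume "\<not> eventually P F"
      then have "eventually (\<lambda>x. \<not> P x) G"
        using assms(1,2) filter_leD ultra_not_iff by blast
      with P have "eventually (\<lambda>x. False) G"
        by eventually_elim auto
      then show False
        using assms(3) by (simp add: trivial_limit_def)
    qed
  qed
qed (fact assms)

lemma ultra_filtermap: "ultra F \<Longrightarrow> ultra (filtermap f F)"
  unfolding ultra_def eventually_filtermap filtermap_bot_iff by blast

text \<open>A property is eventual for the infimum of a chain only if it is so for a member. This is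
  the compactness behind the uses of Zorn's lemma.\<close>

lemma Inf_chain_neq_bot:
  assumes "C \<noteq> {}" "bot \<notin> C" "\<And>F G. F \<in> C \<Longrightarrow> G \<in> C \<Longrightarrow> F \<le> G \<or> G \<le> F"
  shows "Inf C \<noteq> (bot :: 'a filter)"
proof -
  have "eventually P (Inf C) \<longleftrightarrow> (\<exists>F\<in>C. eventually P F)" for P
    using assms by (intro eventually_Inf_base) (metis inf.absorb1 inf.absorb2 order_refl)+
  then show ?thesis
    using assms(2) by (metis trivial_limit_def)
qed

text \<open>A filter stands for the closed set of ultrafilters below it and \<open>Inf\<close> for
  intersection. Minimal closed sets obtained here will be ultrafilters, closed subsemigroups and
  closed left ideals.\<close>

lemma filter_Zorn:
  fixes F :: "'a filter"
  assumes "\<Phi> F" "F \<noteq> bot"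
    and Inf: "\<And>C. C \<noteq> {} \<Longrightarrow> (\<And>F. F \<in> C \<Longrightarrow> \<Phi> F) \<Longrightarrow> \<Phi> (Inf C)"
  obtains G where "\<Phi> G" "G \<noteq> bot" "G \<le> F"
    "\<And>H. \<Phi> H \<Longrightarrow> H \<noteq> bot \<Longrightarrow> H \<le> G \<Longrightarrow> H = G"
proof -
  let ?A = "{G. \<Phi> G \<and> G \<noteq> bot \<and> G \<le> F}"
  have "\<exists>m\<in>?A. \<forall>a\<in>?A. a \<le> m \<longrightarrow> a = m"
  proof (rule predicate_Zorn[of ?A "(\<ge>)"])
    show "partial_order_on ?A (relation_of (\<ge>) ?A)"
      by (rule partial_order_on_relation_ofI) auto
    fix C assume "C \<in> Chains (relation_of (\<ge>) ?A)"
    then have C: "C \<subseteq> ?A" "\<And>F G. F \<in> C \<Longrightarrow> G \<in> C \<Longrightarrow> F \<le> G \<or> G \<le> F"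
      unfolding Chains_def relation_of_def by auto
    show "\<exists>u\<in>?A. \<forall>a\<in>C. u \<le> a"
    proof (cases "C = {}")
      case True
      then show ?thesis using assms by auto
    next
      case False
      have "Inf C \<noteq> bot"
        by (rule Inf_chain_neq_bot) (use False C in auto)
      moreover have "\<Phi> (Inf C)"
        by (rule Inf[OF False]) (use C(1) in auto)
      moreover have "Inf C \<le> F"
      proof -
        obtain H where "H \<in> C"
          using False by blast
        then have "Inf C \<le> H" "H \<le> F"
          using C(1) by (auto intro: Inf_lower)
        then show ?thesis
          by (rule order_trans)
      qed
      ultimately show ?thesis
        by (intro bexI[of _ "Inf C"]) (auto intro: Inf_lower)
    qed
  qed
  then obtain G where "G \<in> ?A" "\<And>H. H \<in> ?A \<Longrightarrow> H \<le> G \<Longrightarrow> H = G"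
    by blast
  then show ?thesis
    using that[of G] order_trans by blast
qed

lemma ultra_exists:
  fixes F :: "'a filter"
  assumes "F \<noteq> bot"
  obtains U where "ultra U" "U \<le> F"
proof -
  obtain U where U: "U \<noteq> bot" "U \<le> F" "\<And>H. H \<noteq> bot \<Longrightarrow> H \<le> U \<Longrightarrow> H = U"
    using filter_Zorn[of "\<lambda>_. True" F] assms by metis
  have "eventually P U \<or> eventually (\<lambda>x. \<not> P x) U" for P
  proof (cases "inf U (principal {x. P x}) = bot")
    case True
    then show ?thesis
      by (simp add: trivial_limit_def eventually_inf_principal)
  next
    case False
    then have *: "inf U (principal {x. P x}) = U"
      using U(3) inf_le1 by metis
    have "eventually P (inf U (principal {x. P x}))"
      by (simp add: eventually_inf_principal)
    then have "eventually P U"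
      by (simp only: *)
    then show ?thesis ..
  qed
  then show ?thesis
    using U that unfolding ultra_def by blast
qed

section \<open>The semigroup of ultrafilters on words\<close>

definition star :: "'a list filter \<Rightarrow> 'a list filter \<Rightarrow> 'a list filter" (infixl "\<diamondop>" 70) where
  "p \<diamondop> q = Abs_filter (\<lambda>P. eventually (\<lambda>u. eventually (\<lambda>v. P (u @ v)) q) p)"

lemma eventually_star:
  "eventually P (p \<diamondop> q) \<longleftrightarrow> eventually (\<lambda>u. eventually (\<lambda>v. P (u @ v)) q) p"
  unfolding star_def
proof (rule eventually_Abs_filter, rule is_filter.intro)
  fix P Q :: "'a list \<Rightarrow> bool"
  assume "\<forall>x. P x \<longrightarrow> Q x" "eventually (\<lambda>u. eventually (\<lambda>v. P (u @ v)) q) p"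
  then show "eventually (\<lambda>u. eventually (\<lambda>v. Q (u @ v)) q) p"
    by (elim eventually_mono) simp
qed (simp_all add: eventually_conj_iff)

lemma star_assoc: "p \<diamondop> q \<diamondop> r = p \<diamondop> (q \<diamondop> r)"
  by (simp add: filter_eq_iff eventually_star)

lemma star_mono:
  assumes "p \<le> p'" "q \<le> q'"
  shows "p \<diamondop> q \<le> p' \<diamondop> q'"
proof (rule filter_leI)
  fix P assume "eventually P (p' \<diamondop> q')"
  then have "eventually (\<lambda>u. eventually (\<lambda>v. P (u @ v)) q') p"
    using assms(1) by (simp add: eventually_star filter_leD)
  then show "eventually P (p \<diamondop> q)"
    unfolding eventually_star by eventually_elim (rule filter_leD[OF assms(2)])
qed

lemma star_neq_bot: "p \<noteq> bot \<Longrightarrow> q \<noteq> bot \<Longrightarrow> p \<diamondop> q \<noteq> bot"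
  by (simp add: trivial_limit_def eventually_star)

lemma ultra_star:
  assumes "ultra p" "ultra q"
  shows "ultra (p \<diamondop> q)"
  using assms star_neq_bot[of p q] ultra_not_iff[of p] ultra_not_iff[of q]
  by (simp add: ultra_def[of "p \<diamondop> q"] eventually_star) (simp add: ultra_def)

lemma filtermap_star:
  assumes "\<And>u v. h (u @ v) = h u @ h v"
  shows "filtermap h (p \<diamondop> q) = filtermap h p \<diamondop> filtermap h q"
  by (simp add: filter_eq_iff eventually_star eventually_filtermap assms)

lemma principal_star: "principal A \<diamondop> principal B = principal {u @ v | u v. u \<in> A \<and> v \<in> B}"
  by (auto simp: filter_eq_iff eventually_star eventually_principal)

text \<open>The right adjoint of right multiplication by \<open>q\<close>. For an ultrafilter
  \<open>q\<close> it is the preimage of the closed set \<open>f\<close>; that this preimage is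
  given by a filter is the continuity of right multiplication.\<close>

definition quotient_filter :: "'a list filter \<Rightarrow> 'a list filter \<Rightarrow> 'a list filter" where
  "quotient_filter q f = (INF P\<in>{P. eventually P f}. principal {u. eventually (\<lambda>v. P (u @ v)) q})"

lemma le_quotient_filter_iff: "p \<le> quotient_filter q f \<longleftrightarrow> p \<diamondop> q \<le> f"
  by (simp add: quotient_filter_def le_INF_iff le_principal le_filter_def[of "p \<diamondop> q"] eventually_star)

lemma eventually_quotient_filter:
  "eventually R (quotient_filter q f) \<longleftrightarrow>
     (\<exists>P. eventually P f \<and> (\<forall>u. eventually (\<lambda>v. P (u @ v)) q \<longrightarrow> R u))"
  unfolding quotient_filter_def
proof (subst eventually_INF_base)
  fix P Q assume "P \<in> {P. eventually P f}" "Q \<in> {P. eventually P f}"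
  then show "\<exists>S\<in>{P. eventually P f}. principal {u. eventually (\<lambda>v. S (u @ v)) q}
      \<le> inf (principal {u. eventually (\<lambda>v. P (u @ v)) q}) (principal {u. eventually (\<lambda>v. Q (u @ v)) q})"
    by (intro bexI[of _ "\<lambda>x. P x \<and> Q x"]) (auto simp: eventually_conj_iff)
qed (auto simp: eventually_principal intro: exI[of _ "\<lambda>_. True"])

text \<open>If \<open>F\<close> missed the preimage of \<open>f\<close>, some property
  \<open>P\<close> of \<open>f\<close> would fail for \<open>q\<close>-many extensions of
  \<open>F\<close>-many words, as \<open>q\<close> decides every property. Then \<open>f\<close>
  would also contain the negation of \<open>P\<close>.\<close>

lemma inf_quotient_filter_neq_bot:
  assumes "ultra q" "f \<noteq> bot" "f \<le> F \<diamondop> q"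
  shows "inf F (quotient_filter q f) \<noteq> bot"
proof
  assume "inf F (quotient_filter q f) = bot"
  then obtain P Q where P: "eventually P f" and Q: "eventually Q F"
    and PQ: "\<And>u. Q u \<Longrightarrow> \<not> eventually (\<lambda>v. P (u @ v)) q"
    unfolding trivial_limit_def eventually_inf eventually_quotient_filter by blast
  from Q have "eventually (\<lambda>u. eventually (\<lambda>v. \<not> P (u @ v)) q) F"
    by eventually_elim (use PQ ultra_not_iff[OF assms(1)] in blast)
  then have "eventually (\<lambda>v. \<not> P v) f"
    using assms(3) filter_leD by (fastforce simp: eventually_star)
  with P have "eventually (\<lambda>_. False) f"
    by eventually_elim auto
  then show False
    using assms(2) by (simp add: trivial_limit_def)
qed

text \<open>Any ultrafilter \<open>g\<close> below \<open>F\<close> in the preimage of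
  \<open>f\<close> will do: \<open>g \<diamondop> q\<close> is proper and finer than the ultrafilter
  \<open>f\<close>, hence equal to it.\<close>

lemma star_surj:
  assumes "ultra q" "ultra f" "f \<le> F \<diamondop> q"
  obtains g where "ultra g" "g \<le> F" "f = g \<diamondop> q"
proof -
  obtain g where g: "ultra g" "g \<le> inf F (quotient_filter q f)"
    using ultra_exists inf_quotient_filter_neq_bot assms ultra_def by metis
  then have "g \<diamondop> q \<le> f"
    by (simp add: le_quotient_filter_iff)
  then have "g \<diamondop> q = f"
    using ultra_minimal assms g(1) ultra_def star_neq_bot by metis
  then show ?thesis
    using g that by auto
qed

text \<open>The Ellis-Numakura lemma. A minimal closed subsemigroup \<open>G\<close> satisfies
  \<open>G \<diamondop> U = G\<close> for \<open>U\<close> in it, so the elements fixing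
  \<open>U\<close> form a nonempty closed subsemigroup, which is all of \<open>G\<close>. Hence
  \<open>G = G \<diamondop> U \<le> U\<close>.\<close>

lemma idempotent_exists:
  fixes F :: "'a list filter"
  assumes "F \<noteq> bot" "F \<diamondop> F \<le> F"
  obtains U where "ultra U" "U \<le> F" "U \<diamondop> U = U"
proof -
  obtain G where G: "G \<diamondop> G \<le> G" "G \<noteq> bot" "G \<le> F"
    and min: "\<And>H. H \<diamondop> H \<le> H \<Longrightarrow> H \<noteq> bot \<Longrightarrow> H \<le> G \<Longrightarrow> H = G"
  proof (rule filter_Zorn[of "\<lambda>G. G \<diamondop> G \<le> G" F])
    fix C :: "'a list filter set" assume C: "\<And>F. F \<in> C \<Longrightarrow> F \<diamondop> F \<le> F"
    then show "Inf C \<diamondop> Inf C \<le> Inf C"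
      by (intro Inf_greatest) (meson Inf_lower order_trans star_mono)
  qed (use assms in auto)
  obtain U where U: "ultra U" "U \<le> G"
    using ultra_exists G(2) by metis
  have bot: "U \<noteq> bot" using U(1) by (simp add: ultra_def)
  have GU: "G \<diamondop> U = G"
  proof (rule min)
    have "G \<diamondop> U \<diamondop> (G \<diamondop> U) \<le> G \<diamondop> G \<diamondop> (G \<diamondop> U)"
      by (intro star_mono order_refl U)
    also have "\<dots> \<le> G \<diamondop> (G \<diamondop> U)"
      by (intro star_mono order_refl G)
    also have "\<dots> = G \<diamondop> G \<diamondop> U"
      by (simp add: star_assoc)
    also have "\<dots> \<le> G \<diamondop> U"
      by (intro star_mono order_refl G)
    finally show "G \<diamondop> U \<diamondop> (G \<diamondop> U) \<le> G \<diamondop> U" .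
    show "G \<diamondop> U \<le> G"
      using G(1) U(2) by (meson order_refl order_trans star_mono)
  qed (use G bot star_neq_bot in auto)
  \<comment> \<open>The closed subsemigroup of those \<open>p\<close> in \<open>G\<close> with
    \<open>p \<diamondop> U = U\<close>.\<close>
  have "inf G (quotient_filter U U) = G"
  proof (rule min)
    have "quotient_filter U U \<diamondop> quotient_filter U U \<diamondop> U \<le> quotient_filter U U \<diamondop> U"
      unfolding star_assoc by (intro star_mono order_refl) (simp flip: le_quotient_filter_iff)
    also have "\<dots> \<le> U"
      by (simp flip: le_quotient_filter_iff)
    finally have "quotient_filter U U \<diamondop> quotient_filter U U \<le> quotient_filter U U"
      by (simp add: le_quotient_filter_iff)
    then show "inf G (quotient_filter U U) \<diamondop> inf G (quotient_filter U U) \<le> inf G (quotient_filter U U)"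
      using G(1) by (meson inf_le1 inf_le2 le_inf_iff order_trans star_mono)
    show "inf G (quotient_filter U U) \<noteq> bot"
      using U bot GU by (intro inf_quotient_filter_neq_bot) auto
  qed auto
  then have "G \<diamondop> U \<le> U"
    by (metis inf_le2 le_quotient_filter_iff)
  then have "G = U"
    using GU U(2) by simp
  then show ?thesis
    using that U G(3) GU by simp
qed

section \<open>Substitution, and the generic ultrafilter of left variable words\<close>

lemma subst_var_append [simp]: "subst_var (u @ v) a = subst_var u a @ subst_var v a"
  by (simp add: subst_var_def)

lemma subst_var_map_Some [simp]: "subst_var (map Some u) a = u"
  by (simp add: subst_var_def comp_def)

lemma subst_var_in_words:
  "set v \<subseteq> insert None (Some ` {1..k}) \<Longrightarrow> a \<in> {1..k} \<Longrightarrow> subst_var v a \<in> words k"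
  by (auto simp: subst_var_def words_def split: option.splits)

lemma left_var_word_append:
  "left_var_word k u \<Longrightarrow> set v \<subseteq> insert None (Some ` {1..k}) \<Longrightarrow> left_var_word k (u @ v)"
  by (auto simp: left_var_word_def)

text \<open>In the proof, \<open>J\<close> is a minimal closed left ideal of ultrafilters on words and \<open>W\<close> an idempotent in it.
  Choosing \<open>V\<close> in \<open>L \<diamondop> W\<close> puts \<open>V\<close> evaluated at \<open>a\<close> into \<open>J\<close>, where \<open>p \<diamondop> q = p\<close> for idempotents.\<close>

lemma generic_ultrafilter:
  obtains V where "ultra V" "V \<le> principal {v. left_var_word k v}" "V \<diamondop> V = V"
    "\<And>a. a \<in> {1..k} \<Longrightarrow> V \<diamondop> filtermap (\<lambda>v. map Some (subst_var v a)) V = V"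
proof -
  \<comment> \<open>Constant words are embedded by \<open>Some\<close>, so that \<open>T\<close>,
    \<open>L\<close> and \<open>A\<close> are closed subsemigroups of one semigroup.\<close>
  define T where "T = principal (map Some ` words k)"
  define L where "L = principal {v. left_var_word k v}"
  define A where "A = principal {v. set v \<subseteq> insert None (Some ` {1..k})}"
  have T: "T \<noteq> bot" and L: "L \<noteq> bot"
    by (auto simp: T_def L_def words_def left_var_word_def principal_eq_bot_iff intro: exI[of _ "[None]"] exI[of _ "[]"])
  have TT: "T \<diamondop> T \<le> T"
    unfolding T_def principal_star by (force simp: words_def simp flip: map_append)
  have LA: "L \<diamondop> A \<le> L"
    unfolding L_def A_def principal_star by (auto intro: left_var_word_append simp del: One_nat_def)
  have AA: "A \<diamondop> A \<le> A"
    unfolding A_def principal_star by auto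
  have TA: "T \<le> A" and LA': "L \<le> A"
    by (auto simp: T_def A_def L_def words_def left_var_word_def subset_iff image_iff)
  obtain J where J: "T \<diamondop> J \<le> J" "J \<noteq> bot" "J \<le> T"
    and min: "\<And>H. T \<diamondop> H \<le> H \<Longrightarrow> H \<noteq> bot \<Longrightarrow> H \<le> J \<Longrightarrow> H = J"
  proof (rule filter_Zorn[of "\<lambda>J. T \<diamondop> J \<le> J" T])
    fix C assume "\<And>F. F \<in> C \<Longrightarrow> T \<diamondop> F \<le> F"
    then show "T \<diamondop> Inf C \<le> Inf C"
      by (intro Inf_greatest) (meson Inf_lower order_refl order_trans star_mono)
  qed (use T TT in auto)
  \<comment> \<open>By minimality, every nonempty closed part of the left ideal \<open>J\<close>
    generates it.\<close>
  have gen: "T \<diamondop> H = J" if "H \<le> J" "H \<noteq> bot" for H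
  proof (rule min)
    show "T \<diamondop> (T \<diamondop> H) \<le> T \<diamondop> H"
      unfolding star_assoc[symmetric] by (intro star_mono TT order_refl)
    show "T \<diamondop> H \<le> J"
      using J(1) that(1) by (meson order_refl order_trans star_mono)
  qed (use T that star_neq_bot in auto)
  have "J \<diamondop> J \<le> J"
    using J by (meson order_refl order_trans star_mono)
  then obtain W where W: "ultra W" "W \<le> J" "W \<diamondop> W = W"
    using idempotent_exists J(2) by metis
  have W_T: "W \<le> T" using W(2) J(3) by simp
  \<comment> \<open>A left variable word stays one whatever is appended, so \<open>L\<close> absorbs
    the inner factors.\<close>
  have "L \<diamondop> W \<diamondop> (L \<diamondop> W) \<le> L \<diamondop> W"
  proof -
    have "L \<diamondop> W \<diamondop> (L \<diamondop> W) = L \<diamondop> (W \<diamondop> L) \<diamondop> W"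
      by (simp add: star_assoc)
    also have "\<dots> \<le> L \<diamondop> (A \<diamondop> A) \<diamondop> W"
      using W_T TA LA' by (intro star_mono order_refl) auto
    also have "\<dots> \<le> L \<diamondop> A \<diamondop> W"
      by (intro star_mono order_refl AA)
    also have "\<dots> \<le> L \<diamondop> W"
      by (intro star_mono order_refl LA)
    finally show ?thesis .
  qed
  moreover have "L \<diamondop> W \<noteq> bot"
    using L W(1) by (simp add: star_neq_bot ultra_def)
  ultimately obtain V where V: "ultra V" "V \<le> L \<diamondop> W" "V \<diamondop> V = V"
    using idempotent_exists by metis
  obtain g where g: "g \<le> L" "V = g \<diamondop> W"
    using star_surj[OF W(1) V(1,2)] by metis
  have "V \<le> L \<diamondop> A"
    using V(2) W_T TA by (meson order_refl order_trans star_mono)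
  then have V_L: "V \<le> L"
    using LA by (rule order_trans)
  have "V \<diamondop> filtermap (\<lambda>v. map Some (subst_var v a)) V = V" if a: "a \<in> {1..k}" for a
  proof -
    let ?h = "\<lambda>v. map Some (subst_var v a)"
    have hom: "filtermap ?h (p \<diamondop> q) = filtermap ?h p \<diamondop> filtermap ?h q" for p q
      by (rule filtermap_star) simp
    define Va where "Va = filtermap ?h V"
    have Va: "ultra Va" "Va \<diamondop> Va = Va"
      using V by (simp_all add: Va_def ultra_filtermap flip: hom)
    \<comment> \<open>\<open>W\<close> lives on constant words, which the substitution fixes; only
      the factor \<open>g\<close> of \<open>V\<close> changes, and it moves into
      \<open>T\<close>.\<close>
    have "eventually (\<lambda>v. ?h v = v) W"
      by (rule filter_leD[OF W_T]) (auto simp: T_def eventually_principal)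
    then have "filtermap ?h W = W"
      unfolding filter_eq_iff eventually_filtermap
      by (intro allI eventually_subst) (elim eventually_mono, simp)
    then have "Va = filtermap ?h g \<diamondop> W"
      by (simp add: Va_def g(2) hom)
    moreover have "filtermap ?h g \<le> T"
    proof -
      have "filtermap ?h g \<le> filtermap ?h L"
        by (rule filtermap_mono[OF g(1)])
      also have "\<dots> \<le> T"
        using a by (auto simp: L_def T_def left_var_word_def intro!: imageI subst_var_in_words)
      finally show ?thesis .
    qed
    ultimately have "Va \<le> T \<diamondop> J"
      using W(2) by (simp add: star_mono)
    then have "Va \<le> J"
      using J(1) by (rule order_trans)
    \<comment> \<open>\<open>Va\<close> generates \<open>J\<close>, so \<open>W\<close> is a left
      multiple of the idempotent \<open>Va\<close>. Hence \<open>Va\<close> is a right identity for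
      \<open>W\<close>, and thereby for \<open>V\<close>.\<close>
    then have "W \<le> T \<diamondop> Va"
      using gen[of Va] Va(1) W(2) by (simp add: ultra_def)
    then obtain g' where "W = g' \<diamondop> Va"
      using star_surj[OF Va(1) W(1)] by metis
    then have "W \<diamondop> Va = W"
      by (simp add: star_assoc Va(2))
    then have "V \<diamondop> Va = V"
      by (simp add: g(2) star_assoc)
    then show ?thesis
      by (simp add: Va_def)
  qed
  with V V_L that show ?thesis
    unfolding L_def by blast
qed

subsection \<open>Generic sequences of variable words\<close>

text \<open>The node at position \<open>s\<close> of the tree with empty root. As
  \<open>map2\<close> stops at the shorter list, a short position reads only the initial part of
  \<open>vs\<close>.\<close>

definition inst :: "nat option list list \<Rightarrow> nat list \<Rightarrow> nat list" where
  "inst vs s = concat (map2 subst_var vs s)"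

lemma inst_Nil [simp]: "inst vs [] = []"
  by (simp add: inst_def)

lemma inst_Cons [simp]: "inst (v # vs) (a # s) = subst_var v a @ inst vs s"
  by (simp add: inst_def)

lemma inst_append_same:
  "length vs = length s \<Longrightarrow> inst (vs @ us) (s @ t) = inst vs s @ inst us t"
  by (simp add: inst_def)

lemma inst_append_short: "length s \<le> length vs \<Longrightarrow> inst (vs @ us) s = inst vs s"
  by (simp add: inst_def zip_append1)

lemma inst_in_words:
  assumes "\<forall>v\<in>set vs. left_var_word k v" "s \<in> words k"
  shows "inst vs s \<in> words k"
proof -
  have "set (subst_var v a) \<subseteq> {1..k}" if va: "(v, a) \<in> set (zip vs s)" for v a
  proof -
    have "v \<in> set vs" "a \<in> set s"
      using va by (auto dest: set_zip_leftD set_zip_rightD)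
    then have "set v \<subseteq> insert None (Some ` {1..k})" "a \<in> {1..k}"
      using assms by (auto simp: left_var_word_def words_def simp del: One_nat_def atLeastAtMost_iff)
    then show ?thesis
      using subst_var_in_words by (auto simp: words_def simp del: One_nat_def)
  qed
  then show ?thesis
    unfolding inst_def words_def by fastforce
qed

text \<open>The iterated (Fubini) power of \<open>V\<close>. The last word belongs to the innermost
  quantifier, so it can be split or prolonged while the earlier ones stay fixed.\<close>

primrec pow :: "'a filter \<Rightarrow> nat \<Rightarrow> 'a list filter" where
  "pow V 0 = principal {[]}"
| "pow V (Suc n) = pow V n \<diamondop> filtermap (\<lambda>v. [v]) V"

lemma eventually_pow_Suc:
  "eventually P (pow V (Suc n)) \<longleftrightarrow> eventually (\<lambda>vs. eventually (\<lambda>v. P (vs @ [v])) V) (pow V n)"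
  by (simp add: eventually_star eventually_filtermap)

lemma ultra_pow: "ultra V \<Longrightarrow> ultra (pow V n)"
proof (induction n)
  case 0
  show ?case
    by (simp add: ultra_def principal_eq_bot_iff eventually_principal)
next
  case (Suc n)
  then show ?case
    by (simp add: ultra_star ultra_filtermap)
qed

lemma eventually_pow_length: "eventually (\<lambda>vs. length vs = n) (pow V n)"
proof (induction n)
  case (Suc n)
  then show ?case
    unfolding eventually_pow_Suc by (elim eventually_mono) simp
qed (simp add: eventually_principal)

lemma eventually_pow_all:
  assumes "eventually P V"
  shows "eventually (\<lambda>vs. \<forall>v\<in>set vs. P v) (pow V n)"
proof (induction n)
  case (Suc n)
  then show ?case
    unfolding eventually_pow_Suc
    by (elim eventually_mono) (use assms in \<open>auto elim: eventually_mono\<close>)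
qed (simp add: eventually_principal)

lemma eventually_pow_inst_snoc:
  assumes "length s = n" "length s' = n"
  shows "eventually (\<lambda>vs. R (inst vs (s @ [a])) (inst vs (s' @ [b]))) (pow V (Suc n)) \<longleftrightarrow>
    eventually (\<lambda>vs. eventually (\<lambda>v. R (inst vs s @ subst_var v a) (inst vs s' @ subst_var v b)) V) (pow V n)"
  unfolding eventually_pow_Suc
  by (rule eventually_subst, rule eventually_mono[OF eventually_pow_length])
     (simp add: assms inst_append_same)

lemma eventually_pow_inst_snoc':
  assumes "length s \<le> n" "length s' = n"
  shows "eventually (\<lambda>vs. R (inst vs s) (inst vs (s' @ [b]))) (pow V (Suc n)) \<longleftrightarrow>
    eventually (\<lambda>vs. eventually (\<lambda>v. R (inst vs s) (inst vs s' @ subst_var v b)) V) (pow V n)"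
  unfolding eventually_pow_Suc
  by (rule eventually_subst, rule eventually_mono[OF eventually_pow_length])
     (simp add: assms inst_append_same inst_append_short)

text \<open>Variable words beyond the length of both positions are never read.\<close>

lemma eventually_pow_inst_lift:
  assumes "n \<le> n'" "length s \<le> n" "length s' \<le> n"
    and "eventually (\<lambda>vs. R (inst vs s) (inst vs s')) (pow V n)"
  shows "eventually (\<lambda>vs. R (inst vs s) (inst vs s')) (pow V n')"
  using assms(1)
proof (induction n' rule: dec_induct)
  case (step n')
  from eventually_conj[OF eventually_pow_length step.IH] show ?case
    unfolding eventually_pow_Suc
    by (elim eventually_mono) (use assms(2,3) step(1) in \<open>simp add: inst_append_short\<close>)
qed (fact assms)

text \<open>\<open>forces V t t' s s'\<close>: whatever relation holds between the evaluations of \<open>t\<close> and \<open>t'\<close> at a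
  \<open>V\<close>-generic sequence of variable words also holds for \<open>s\<close> and \<open>s'\<close>; in a generic tree the pair
  \<open>(s, s')\<close> plays the role of \<open>(t, t')\<close> in some subtree.\<close>

definition forces :: "nat option list filter \<Rightarrow> nat list \<Rightarrow> nat list \<Rightarrow> nat list \<Rightarrow> nat list \<Rightarrow> bool" where
  "forces V t t' s s' \<longleftrightarrow> (\<forall>R. eventually (\<lambda>vs. R (inst vs t) (inst vs t')) (pow V (length t')) \<longrightarrow>
     eventually (\<lambda>vs. R (inst vs s) (inst vs s')) (pow V (length s')))"

lemma forces_refl: "forces V t t' t t'"
  by (simp add: forces_def)

text \<open>Since \<open>forces\<close> covers all relations, it applies to the relation that holds
  when \<open>V\<close>-many further words, evaluated at \<open>a\<close> and at \<open>b\<close>,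
  lead to \<open>R\<close>.\<close>

lemma forces_snoc:
  assumes "forces V t t' s s'" "length t = length t'" "length s = length s'"
  shows "forces V (t @ [a]) (t' @ [b]) (s @ [a]) (s' @ [b])"
  unfolding forces_def
proof (intro allI impI)
  fix R :: "nat list \<Rightarrow> nat list \<Rightarrow> bool"
  let ?R = "\<lambda>x y. eventually (\<lambda>v. R (x @ subst_var v a) (y @ subst_var v b)) V"
  assume "eventually (\<lambda>vs. R (inst vs (t @ [a])) (inst vs (t' @ [b]))) (pow V (length (t' @ [b])))"
  then have "eventually (\<lambda>vs. ?R (inst vs t) (inst vs t')) (pow V (length t'))"
    using assms(2) by (simp add: eventually_pow_inst_snoc del: pow.simps(2))
  then have "eventually (\<lambda>vs. ?R (inst vs s) (inst vs s')) (pow V (length s'))"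
    using assms(1)[unfolded forces_def, rule_format, of ?R] by blast
  then show "eventually (\<lambda>vs. R (inst vs (s @ [a])) (inst vs (s' @ [b]))) (pow V (length (s' @ [b])))"
    using assms(3) by (simp add: eventually_pow_inst_snoc del: pow.simps(2))
qed

lemma forces_snoc_right:
  assumes "forces V t t' s s'" "length t \<le> length t'" "length s \<le> length s'"
  shows "forces V t (t' @ [b]) s (s' @ [b])"
  unfolding forces_def
proof (intro allI impI)
  fix R :: "nat list \<Rightarrow> nat list \<Rightarrow> bool"
  let ?R = "\<lambda>x y. eventually (\<lambda>v. R x (y @ subst_var v b)) V"
  assume "eventually (\<lambda>vs. R (inst vs t) (inst vs (t' @ [b]))) (pow V (length (t' @ [b])))"
  then have "eventually (\<lambda>vs. ?R (inst vs t) (inst vs t')) (pow V (length t'))"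
    using assms(2) by (simp add: eventually_pow_inst_snoc' del: pow.simps(2))
  then have "eventually (\<lambda>vs. ?R (inst vs s) (inst vs s')) (pow V (length s'))"
    using assms(1)[unfolded forces_def, rule_format, of ?R] by blast
  then show "eventually (\<lambda>vs. R (inst vs s) (inst vs (s' @ [b]))) (pow V (length (s' @ [b])))"
    using assms(3) by (simp add: eventually_pow_inst_snoc' del: pow.simps(2))
qed

text \<open>By \<open>V \<diamondop> V = V\<close> the last variable word of the subtree may be
  taken to be a product of two, both read with the letters \<open>a\<close> and
  \<open>b\<close>.\<close>

lemma forces_repeat:
  assumes V: "V \<diamondop> V = V"
    and "forces V (t @ [a]) (t' @ [b]) s s'" "length t = length t'" "length s = length s'"
  shows "forces V (t @ [a]) (t' @ [b]) (s @ [a]) (s' @ [b])"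
  unfolding forces_def
proof (intro allI impI)
  fix R :: "nat list \<Rightarrow> nat list \<Rightarrow> bool"
  let ?R = "\<lambda>x y. eventually (\<lambda>v. R (x @ subst_var v a) (y @ subst_var v b)) V"
  have *: "?R x y \<longleftrightarrow> eventually (\<lambda>v. ?R (x @ subst_var v a) (y @ subst_var v b)) V" for x y
    by (subst V[symmetric]) (simp add: eventually_star)
  assume "eventually (\<lambda>vs. R (inst vs (t @ [a])) (inst vs (t' @ [b]))) (pow V (length (t' @ [b])))"
  then have "eventually (\<lambda>vs. ?R (inst vs t) (inst vs t')) (pow V (length t'))"
    using assms(3) by (simp add: eventually_pow_inst_snoc del: pow.simps(2))
  then have "eventually (\<lambda>vs. eventually (\<lambda>v. ?R (inst vs t @ subst_var v a) (inst vs t' @ subst_var v b)) V) (pow V (length t'))"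
    by (subst (asm) *)
  then have "eventually (\<lambda>vs. ?R (inst vs (t @ [a])) (inst vs (t' @ [b]))) (pow V (length (t' @ [b])))"
    using assms(3) eventually_pow_inst_snoc[of t "length t'" t' ?R a b V] by (simp del: pow.simps(2))
  then have "eventually (\<lambda>vs. ?R (inst vs s) (inst vs s')) (pow V (length s'))"
    using assms(2)[unfolded forces_def, rule_format, of ?R] by blast
  then show "eventually (\<lambda>vs. R (inst vs (s @ [a])) (inst vs (s' @ [b]))) (pow V (length (s' @ [b])))"
    using assms(4) by (simp add: eventually_pow_inst_snoc del: pow.simps(2))
qed

text \<open>The equation on \<open>V\<close> lets the last variable word of the subtree be prolonged
  by a constant word, the evaluation at \<open>c\<close> of a new variable word. There must be a
  word to prolong, whence \<open>t \<noteq> []\<close>.\<close>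

lemma forces_const:
  assumes V: "V \<diamondop> filtermap (\<lambda>v. map Some (subst_var v c)) V = V"
    and "forces V t t' s s'" "length t = length t'" "t \<noteq> []" "length s = length s'"
  shows "forces V t t' (s @ [c]) (s' @ [c])"
  unfolding forces_def
proof (intro allI impI)
  fix R :: "nat list \<Rightarrow> nat list \<Rightarrow> bool"
  obtain t0 a where t: "t = t0 @ [a]"
    using assms(4) by (metis rev_exhaust)
  obtain t0' b where t': "t' = t0' @ [b]"
    using assms(3,4) by (metis length_0_conv rev_exhaust)
  have len: "length t0 = length t0'"
    using assms(3) t t' by simp
  let ?R = "\<lambda>x y. eventually (\<lambda>v. R (x @ subst_var v c) (y @ subst_var v c)) V"
  have *: "eventually (\<lambda>v. R (x @ subst_var v a) (y @ subst_var v b)) V \<longleftrightarrow>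
      eventually (\<lambda>v. ?R (x @ subst_var v a) (y @ subst_var v b)) V" for x y
    by (subst V[symmetric]) (simp add: eventually_star eventually_filtermap)
  assume "eventually (\<lambda>vs. R (inst vs t) (inst vs t')) (pow V (length t'))"
  then have "eventually (\<lambda>vs. eventually (\<lambda>v. R (inst vs t0 @ subst_var v a) (inst vs t0' @ subst_var v b)) V)
      (pow V (length t0'))"
    using len by (simp add: t t' eventually_pow_inst_snoc del: pow.simps(2))
  then have "eventually (\<lambda>vs. eventually (\<lambda>v. ?R (inst vs t0 @ subst_var v a) (inst vs t0' @ subst_var v b)) V)
      (pow V (length t0'))"
    by (subst (asm) *)
  then have "eventually (\<lambda>vs. ?R (inst vs t) (inst vs t')) (pow V (length t'))"
    using len eventually_pow_inst_snoc[of t0 "length t0'" t0' ?R a b V]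
    by (simp add: t t' del: pow.simps(2))
  then have "eventually (\<lambda>vs. ?R (inst vs s) (inst vs s')) (pow V (length s'))"
    using assms(2)[unfolded forces_def, rule_format, of ?R] by blast
  then show "eventually (\<lambda>vs. R (inst vs (s @ [c])) (inst vs (s' @ [c]))) (pow V (length (s' @ [c])))"
    using assms(5) by (simp add: eventually_pow_inst_snoc del: pow.simps(2))
qed

text \<open>Here only the longer position reads the prolonged variable word, so the constant enters
  the second word alone.\<close>

lemma forces_const_right:
  assumes V: "V \<diamondop> filtermap (\<lambda>v. map Some (subst_var v c)) V = V"
    and "forces V t t' s s'" "length t < length t'" "length s \<le> length s'"
  shows "forces V t t' s (s' @ [c])"
  unfolding forces_def
proof (intro allI impI)
  fix R :: "nat list \<Rightarrow> nat list \<Rightarrow> bool"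
  obtain t0' b where t': "t' = t0' @ [b]"
    using assms(3) by (metis less_zeroE list.size(3) rev_exhaust)
  have len: "length t \<le> length t0'"
    using assms(3) t' by simp
  let ?R = "\<lambda>x y. eventually (\<lambda>v. R x (y @ subst_var v c)) V"
  have *: "eventually (\<lambda>v. R x (y @ subst_var v b)) V \<longleftrightarrow>
      eventually (\<lambda>v. ?R x (y @ subst_var v b)) V" for x y
    by (subst V[symmetric]) (simp add: eventually_star eventually_filtermap)
  assume "eventually (\<lambda>vs. R (inst vs t) (inst vs t')) (pow V (length t'))"
  then have "eventually (\<lambda>vs. eventually (\<lambda>v. R (inst vs t) (inst vs t0' @ subst_var v b)) V)
      (pow V (length t0'))"
    using len by (simp add: t' eventually_pow_inst_snoc' del: pow.simps(2))
  then have "eventually (\<lambda>vs. eventually (\<lambda>v. ?R (inst vs t) (inst vs t0' @ subst_var v b)) V)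
      (pow V (length t0'))"
    by (subst (asm) *)
  then have "eventually (\<lambda>vs. ?R (inst vs t) (inst vs t')) (pow V (length t'))"
    using len eventually_pow_inst_snoc'[of t "length t0'" t0' ?R b V]
    by (simp add: t' del: pow.simps(2))
  then have "eventually (\<lambda>vs. ?R (inst vs s) (inst vs s')) (pow V (length s'))"
    using assms(2)[unfolded forces_def, rule_format, of ?R] by blast
  then show "eventually (\<lambda>vs. R (inst vs s) (inst vs (s' @ [c]))) (pow V (length (s' @ [c])))"
    using assms(4) by (simp add: eventually_pow_inst_snoc' del: pow.simps(2))
qed

locale generic =
  fixes V :: "nat option list filter" and k :: nat
  assumes ultra: "ultra V"
    and left_var: "V \<le> principal {v. left_var_word k v}"
    and idem: "V \<diamondop> V = V"
    and idem_const: "\<And>a. a \<in> {1..k} \<Longrightarrow> V \<diamondop> filtermap (\<lambda>v. map Some (subst_var v a)) V = V"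
begin

lemma forces_repeats:
  assumes "forces V (t @ [a]) (t' @ [b]) s s'" "length t = length t'" "length s = length s'"
  shows "forces V (t @ [a]) (t' @ [b]) (s @ replicate n a) (s' @ replicate n b)"
proof (induction n)
  case (Suc n)
  from forces_repeat[OF idem Suc] show ?case
    using assms by (simp add: replicate_append_same)
qed (simp add: assms)

lemma forces_consts:
  assumes "forces V t t' s s'" "length t = length t'" "t \<noteq> []" "length s = length s'" "cs \<in> words k"
  shows "forces V t t' (s @ cs) (s' @ cs)"
  using assms(5)
proof (induction cs rule: rev_induct)
  case (snoc c cs)
  then have "c \<in> {1..k}" "forces V t t' (s @ cs) (s' @ cs)"
    by (auto simp: words_def)
  from forces_const[OF idem_const[OF this(1)] this(2)] show ?case
    using assms by simp
qed (simp add: assms)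

lemma forces_consts_right:
  assumes "forces V t t' s s'" "length t < length t'" "length s \<le> length s'" "cs \<in> words k"
  shows "forces V t t' s (s' @ cs)"
  using assms(4)
proof (induction cs rule: rev_induct)
  case (snoc c cs)
  then have "c \<in> {1..k}" "forces V t t' s (s' @ cs)"
    by (auto simp: words_def)
  from forces_const_right[OF idem_const[OF this(1)] this(2)] show ?case
    using assms by simp
qed (simp add: assms)

lemma forces_append_right:
  assumes "forces V t t' s s'" "length t \<le> length t'" "length s \<le> length s'"
  shows "forces V t (t' @ e) s (s' @ e)"
proof (induction e rule: rev_induct)
  case (snoc b e)
  from forces_snoc_right[OF snoc] show ?case
    using assms by simp
qed (simp add: assms)

end

section \<open>Chains of words in which every pair plays the role of one given pair\<close>

definition chain_block :: "nat \<Rightarrow> nat \<Rightarrow> nat list \<Rightarrow> nat list \<Rightarrow> nat list" where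
  "chain_block N i t t' = concat (map2 (\<lambda>a b. replicate i b @ replicate (N - i) a) t t')"

lemma length_chain_block:
  "length t = length t' \<Longrightarrow> i \<le> N \<Longrightarrow> length (chain_block N i t t') = N * length t"
  by (induction t t' rule: list_induct2) (simp_all add: chain_block_def)

lemma chain_block_in_words:
  assumes "t \<in> words k" "t' \<in> words k"
  shows "chain_block N i t t' \<in> words k"
  using assms unfolding chain_block_def words_def by (fastforce dest: set_zip_leftD set_zip_rightD)

context generic
begin

text \<open>In the block of letters \<open>a\<close> and \<open>b\<close>, the words for
  \<open>i < j\<close> share \<open>b\<close> at the first \<open>i\<close> places and
  \<open>a\<close> at the last \<open>N - j\<close>; in between, one reads \<open>a\<close> and the
  other \<open>b\<close>. The shared places are constants prolonging the preceding variable word,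
  and the places in between merge into one variable word.\<close>

lemma forces_chain_block:
  assumes "length t = length t'" "t \<in> words k" "t' \<in> words k" "c \<in> {1..k}" "i < j" "j < N"
  shows "forces V (c # t) (c # t') (chain_block N i (c # t) (c # t')) (chain_block N j (c # t) (c # t'))"
  using assms(1-3)
proof (induction t t' rule: rev_induct2)
  case 1
  \<comment> \<open>The block of \<open>c\<close> is \<open>N\<close> copies of \<open>c\<close> for
    every \<open>i\<close>; merged, they give the first variable word.\<close>
  have "forces V ([] @ [c]) ([] @ [c]) ([c] @ replicate (N - 1) c) ([c] @ replicate (N - 1) c)"
    using forces_snoc[OF forces_refl[of V "[]" "[]"], of c c] by (intro forces_repeats) auto
  moreover have "[c] @ replicate (N - 1) c = replicate N c"
    using assms(6) by (cases N) auto
  moreover have "replicate i c @ replicate (N - i) c = replicate N c" if "i < N" for i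
    using that by (simp flip: replicate_add)
  ultimately show ?case
    using assms(5,6) by (simp add: chain_block_def)
next
  case (4 a t b t')
  then have ab: "a \<in> {1..k}" "b \<in> {1..k}" and t: "t \<in> words k" "t' \<in> words k" "length t = length t'"
    by (auto simp: words_def)
  let ?s = "\<lambda>i. chain_block N i (c # t) (c # t')"
  have len: "length (?s i) = N * Suc (length t)" if "i < N" for i
    using that t(3) by (subst length_chain_block) auto
  have chain_block: "chain_block N i (c # t @ [a]) (c # t' @ [b]) = ?s i @ replicate i b @ replicate (N - i) a" for i
    using t(3) by (simp add: chain_block_def)
  have "forces V (c # t) (c # t') (?s i) (?s j)"
    using 4 t by simp
  then have "forces V (c # t) (c # t') (?s i @ replicate i b) (?s j @ replicate i b)"
    using ab t(3) assms(5,6) by (intro forces_consts) (auto simp: len words_def)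
  \<comment> \<open>This place opens the new variable word and exists because \<open>i < j\<close>;
    the \<open>j - i - 1\<close> places after it are merged into it.\<close>
  then have "forces V ((c # t) @ [a]) ((c # t') @ [b])
      ((?s i @ replicate i b) @ [a]) ((?s j @ replicate i b) @ [b])"
    using t(3) assms(5,6) by (intro forces_snoc) (auto simp: len)
  then have "forces V ((c # t) @ [a]) ((c # t') @ [b])
      (((?s i @ replicate i b) @ [a]) @ replicate (j - i - 1) a)
      (((?s j @ replicate i b) @ [b]) @ replicate (j - i - 1) b)"
    using t(3) assms(5,6) by (intro forces_repeats) (auto simp: len)
  then have "forces V ((c # t) @ [a]) ((c # t') @ [b])
      ((((?s i @ replicate i b) @ [a]) @ replicate (j - i - 1) a) @ replicate (N - j) a)
      ((((?s j @ replicate i b) @ [b]) @ replicate (j - i - 1) b) @ replicate (N - j) a)"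
    using t(3) ab assms(5,6) by (intro forces_consts) (auto simp: len words_def)
  moreover have "(((?s i @ replicate i b) @ [a]) @ replicate (j - i - 1) a) @ replicate (N - j) a =
      ?s i @ replicate i b @ replicate (N - i) a"
    using assms(5,6) by (simp flip: replicate_add replicate_Suc)
  moreover have "replicate i b @ [b] @ replicate (j - i - 1) b = replicate j b"
    using assms(5) by (simp flip: replicate_add replicate_Suc)
  then have "(((?s j @ replicate i b) @ [b]) @ replicate (j - i - 1) b) @ replicate (N - j) a =
      ?s j @ replicate j b @ replicate (N - j) a"
    by (simp only: append_assoc)
  ultimately show ?case
    by (simp only: chain_block append_Cons)
qed simp_all

lemma concat_replicate_in_words: "e \<in> words k \<Longrightarrow> concat (replicate n e) \<in> words k"
  by (auto simp: words_def)

text \<open>The first \<open>i\<close> copies of \<open>e\<close> are constants common to both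
  words. The next copy in the word for \<open>j\<close> plays the role of \<open>e\<close>, and the
  remaining \<open>j - i - 1\<close> copies are constants in that word alone.\<close>

lemma forces_chain:
  assumes "length t = length t'" "t \<in> words k" "t' \<in> words k" "e \<in> words k" "c \<in> {1..k}"
    "i < j" "j < N"
  shows "forces V (c # t) (c # t' @ e)
    (chain_block N i (c # t) (c # t') @ concat (replicate i e))
    (chain_block N j (c # t) (c # t') @ concat (replicate j e))"
\<comment> \<open>\<open>forces_consts_right\<close> needs the second position to be strictly
  longer, so the empty \<open>e\<close> is treated apart.\<close>
proof (cases "e = []")
  case True
  then show ?thesis
    using forces_chain_block[OF assms(1-3,5-7)] by simp
next
  case False
  let ?s = "\<lambda>i. chain_block N i (c # t) (c # t')" and ?e = "concat (replicate i e)"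
  have len: "length (?s i) = length (?s j)"
    using assms by (simp add: length_chain_block)
  have "forces V (c # t) (c # t') (?s i @ ?e) (?s j @ ?e)"
    using assms forces_chain_block[OF assms(1-3,5-7)] len
    by (intro forces_consts concat_replicate_in_words) auto
  then have "forces V (c # t) ((c # t') @ e) (?s i @ ?e) ((?s j @ ?e) @ e)"
    using assms(1) len by (intro forces_append_right) auto
  then have "forces V (c # t) ((c # t') @ e) (?s i @ ?e) (((?s j @ ?e) @ e) @ concat (replicate (j - i - 1) e))"
    by (rule forces_consts_right) (use assms len False concat_replicate_in_words in auto)
  moreover have "((?s j @ ?e) @ e) @ concat (replicate (j - i - 1) e) = ?s j @ concat (replicate j e)"
  proof -
    have "?e @ e @ concat (replicate (j - i - 1) e) = concat (replicate (i + Suc (j - i - 1)) e)"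
      by (simp only: replicate_add concat_append replicate_Suc concat.simps append_assoc)
    also have "i + Suc (j - i - 1) = j"
      using assms(6) by simp
    finally show ?thesis
      by simp
  qed
  ultimately show ?thesis
    by simp
qed

text \<open>The common first letter \<open>c\<close> keeps the whole chain inside the left variable words: without
  it, the constants in front of the first variable of a merged word would have no place.\<close>

lemma generic_related:
  fixes N :: nat
  assumes ind: "\<And>s. (\<And>i. i < N \<Longrightarrow> s i \<in> words k) \<Longrightarrow> \<exists>j<N. \<exists>i<j. R (s i) (s j)"
    and "t \<in> words k" "t' \<in> words k" "length t \<le> length t'" "c \<in> {1..k}"
  shows "eventually (\<lambda>vs. R (inst vs (c # t)) (inst vs (c # t'))) (pow V (Suc (length t')))"
proof (rule ccontr)
  assume "\<not> ?thesis"
  then have not: "eventually (\<lambda>vs. \<not> R (inst vs (c # t)) (inst vs (c # t'))) (pow V (Suc (length t')))"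
    using ultra_not_iff[OF ultra_pow[OF ultra]] by blast
  \<comment> \<open>\<open>r\<close> matches \<open>t\<close> letter by letter; only the second word
    reads the surplus \<open>e\<close>.\<close>
  define r e where "r = take (length t) t'" and "e = drop (length t) t'"
  have t': "t' = r @ e" and r: "length t = length r" "r \<in> words k" "e \<in> words k"
    using assms(3,4) by (auto simp: r_def e_def words_def dest: in_set_takeD in_set_dropD)
  define s where "s i = chain_block N i (c # t) (c # r) @ concat (replicate i e)" for i
  have s: "s i \<in> words k" for i
  proof -
    have "chain_block N i (c # t) (c # r) \<in> words k"
      by (rule chain_block_in_words) (use assms r in \<open>auto simp: words_def\<close>)
    then show ?thesis
      using concat_replicate_in_words[OF r(3)] by (auto simp: s_def words_def)
  qed
  \<comment> \<open>Long enough for the whole chain, so that all pairs are evaluated at the same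
    sequence.\<close>
  define n where "n = Max (length ` s ` {..<N})"
  have n: "length (s i) \<le> n" if "i < N" for i
    unfolding n_def using that by (intro Max_ge) auto
  have "eventually (\<lambda>vs. \<not> R (inst vs (s i)) (inst vs (s j))) (pow V n)" if "i < j" "j < N" for i j
  proof -
    have "forces V (c # t) (c # r @ e) (s i) (s j)"
      unfolding s_def using that assms r by (intro forces_chain) auto
    then have "eventually (\<lambda>vs. \<not> R (inst vs (c # t)) (inst vs (c # r @ e))) (pow V (length (c # r @ e)))
        \<longrightarrow> eventually (\<lambda>vs. \<not> R (inst vs (s i)) (inst vs (s j))) (pow V (length (s j)))"
      unfolding forces_def by (rule spec[of _ "\<lambda>x y. \<not> R x y"])
    then have "eventually (\<lambda>vs. \<not> R (inst vs (s i)) (inst vs (s j))) (pow V (length (s j)))"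
      by (rule mp) (use not in \<open>simp add: t' del: pow.simps(2)\<close>)
    moreover have "length (s i) \<le> length (s j)"
      unfolding s_def using that r by (simp add: length_chain_block length_concat sum_list_replicate)
    ultimately show ?thesis
      using n[OF that(2)] eventually_pow_inst_lift[of "length (s j)" n "s i" "s j" "\<lambda>x y. \<not> R x y"]
      by simp
  qed
  then have "eventually (\<lambda>vs. \<forall>p\<in>{(i, j). i < j \<and> j < N}. \<not> R (inst vs (s (fst p))) (inst vs (s (snd p)))) (pow V n)"
    by (intro eventually_ball_finite) (auto intro: finite_subset[of _ "{..<N} \<times> {..<N}"])
  moreover have "eventually (\<lambda>vs. \<forall>v\<in>set vs. left_var_word k v) (pow V n)"
    using left_var by (intro eventually_pow_all) (simp add: le_principal)
  moreover have "pow V n \<noteq> bot"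
    using ultra_pow[OF ultra] unfolding ultra_def by blast
  ultimately obtain us where
    "\<forall>p\<in>{(i, j). i < j \<and> j < N}. \<not> R (inst us (s (fst p))) (inst us (s (snd p)))"
    and "\<forall>v\<in>set us. left_var_word k v"
    using eventually_happens'[OF _ eventually_conj] by blast
  then show False
    using ind[of "\<lambda>i. inst us (s i)"] inst_in_words[OF _ s] by fastforce
qed

end

lemma finite_words_le: "finite {t \<in> words k. length t \<le> n}"
  by (rule finite_subset[OF _ finite_lists_length_le[of "{1..k}" n]]) (auto simp: words_def)

text \<open>Finitely many pairs are generically related at once. All positions begin with
  \<open>c\<close>, so one of the \<open>Suc m\<close> variable words only moves the root. The
  hypothesis admits repeated words, which covers \<open>t = t'\<close>.\<close>

theorem related_tree:
  fixes N :: nat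
  assumes ind: "\<And>s. (\<And>i. i < N \<Longrightarrow> s i \<in> words k) \<Longrightarrow> \<exists>j<N. \<exists>i<j. R (s i) (s j)"
    and sym: "symp R" and c: "c \<in> {1..k}"
  obtains vs where "length vs = Suc m" "\<forall>v\<in>set vs. left_var_word k v"
    "\<forall>t\<in>{t \<in> words k. length t \<le> m}. \<forall>t'\<in>{t \<in> words k. length t \<le> m}.
       R (inst vs (c # t)) (inst vs (c # t'))"
proof -
  obtain V where "generic V k"
    using generic_ultrafilter[of k] unfolding generic_def by metis
  then interpret generic V k .
  let ?F = "pow V (Suc m)"
  let ?T = "{t \<in> words k. length t \<le> m}"
  have *: "eventually (\<lambda>vs. R (inst vs (c # t)) (inst vs (c # t'))) ?F"
    if "t \<in> words k" "t' \<in> words k" "length t \<le> length t'" "length t' \<le> m" for t t'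
    by (rule eventually_pow_inst_lift[of "Suc (length t')"], use that in \<open>simp_all del: pow.simps(2)\<close>)
       (rule generic_related[OF ind that(1-3) c])
  have "eventually (\<lambda>vs. R (inst vs (c # t)) (inst vs (c # t'))) ?F"
    if "t \<in> ?T" "t' \<in> ?T" for t t'
  proof (cases "length t \<le> length t'")
    case True
    then show ?thesis using * that by blast
  next
    case False
    then have "eventually (\<lambda>vs. R (inst vs (c # t')) (inst vs (c # t))) ?F"
      using * that by simp
    then show ?thesis
      by (elim eventually_mono) (rule sympD[OF sym])
  qed
  then have "eventually (\<lambda>vs. \<forall>t\<in>?T. \<forall>t'\<in>?T. R (inst vs (c # t)) (inst vs (c # t'))) ?F"
    by (intro eventually_ball_finite finite_words_le ballI) blast
  moreover have "eventually (\<lambda>vs. \<forall>v\<in>set vs. left_var_word k v) ?F"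
    using left_var by (intro eventually_pow_all) (simp add: le_principal)
  ultimately have "eventually (\<lambda>vs. length vs = Suc m \<and> (\<forall>v\<in>set vs. left_var_word k v) \<and>
      (\<forall>t\<in>?T. \<forall>t'\<in>?T. R (inst vs (c # t)) (inst vs (c # t')))) ?F"
    by (intro eventually_conj eventually_pow_length)
  moreover have "?F \<noteq> bot"
    using ultra_pow[OF ultra] unfolding ultra_def by blast
  ultimately show ?thesis
    using eventually_happens' that by blast
qed

subsection \<open>Carlson-Simpson subtrees\<close>

lemma inst_eq_nth:
  "length s \<le> length vs \<Longrightarrow> inst vs s = concat (map (\<lambda>i. subst_var (vs ! i) (s ! i)) [0..<length s])"
  unfolding inst_def by (intro arg_cong[of _ _ concat] nth_equalityI) auto

text \<open>The empty position is the root, and an index \<open>n\<close> corresponds to positions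
  of length \<open>n + 1\<close>.\<close>

lemma cs_set_eq: "cs_set k w vs = {w @ inst vs s | s. s \<in> words k \<and> length s \<le> length vs}"
proof (intro equalityI subsetI)
  fix y assume "y \<in> cs_set k w vs"
  then consider "y = w" | n a where "n < length vs" "\<forall>i\<le>n. a i \<in> {1..k}"
    "y = w @ concat (map (\<lambda>i. subst_var (vs ! i) (a i)) [0..<Suc n])"
    unfolding cs_set_def by blast
  then show "y \<in> {w @ inst vs s | s. s \<in> words k \<and> length s \<le> length vs}"
  proof cases
    case 1
    then show ?thesis
      by (auto simp: words_def intro!: exI[of _ "[]"])
  next
    case 2
    define s where "s = map a [0..<Suc n]"
    have s: "length s \<le> length vs"
      using 2(1) by (simp add: s_def del: upt_Suc)
    have "y = w @ inst vs s"
      unfolding 2(3) inst_eq_nth[OF s]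
      by (intro arg_cong[of _ _ "\<lambda>x. w @ concat x"] map_cong) (auto simp: s_def simp del: upt_Suc)
    moreover have "s \<in> words k"
      using 2(2) by (auto simp: s_def words_def simp del: upt_Suc)
    ultimately show ?thesis
      using s by blast
  qed
next
  fix y assume "y \<in> {w @ inst vs s | s. s \<in> words k \<and> length s \<le> length vs}"
  then obtain s where s: "y = w @ inst vs s" "s \<in> words k" "length s \<le> length vs"
    by blast
  show "y \<in> cs_set k w vs"
  proof (cases "s = []")
    case True
    then show ?thesis
      using s by (simp add: cs_set_def)
  next
    case False
    then have n: "Suc (length s - 1) = length s" "length s - 1 < length vs"
      using s(3) by (cases s; simp)+
    have "\<forall>i\<le>length s - 1. s ! i \<in> {1..k}"
      using n s(2) nth_mem[of _ s] unfolding words_def by (metis (no_types, lifting) le_imp_less_Suc mem_Collect_eq subsetD)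
    moreover have "y = w @ concat (map (\<lambda>i. subst_var (vs ! i) (s ! i)) [0..<Suc (length s - 1)])"
      unfolding n(1) using s(1) inst_eq_nth[OF s(3)] by simp
    ultimately show ?thesis
      unfolding cs_set_def using n(2) by blast
  qed
qed

section \<open>Composition of variable words\<close>

definition comp_word :: "nat option list list \<Rightarrow> nat option list \<Rightarrow> nat option list" where
  "comp_word ws v = concat (map2 (\<lambda>u c. case c of None \<Rightarrow> u | Some a \<Rightarrow> map Some (subst_var u a)) ws v)"

text \<open>Each word of \<open>vs\<close> consumes as many words of \<open>ws\<close> as it has
  letters, hence the \<open>drop\<close>. The result spans the subtree whose positions in the tree
  of \<open>ws\<close> are described by \<open>vs\<close>.\<close>

fun comp_words :: "nat option list list \<Rightarrow> nat option list list \<Rightarrow> nat option list list" where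
  "comp_words ws [] = []"
| "comp_words ws (v # vs) = comp_word ws v # comp_words (drop (length v) ws) vs"

lemma length_comp_words [simp]: "length (comp_words ws vs) = length vs"
  by (induction vs arbitrary: ws) auto

lemma subst_var_comp_word: "subst_var (comp_word ws v) a = inst ws (subst_var v a)"
proof (induction v arbitrary: ws)
  case (Cons c v)
  then show ?case
    by (cases ws) (auto simp: comp_word_def inst_def subst_var_def comp_def split: option.splits)
qed (simp add: comp_word_def subst_var_def)

lemma inst_comp_words:
  "length (concat vs) \<le> length ws \<Longrightarrow> inst (comp_words ws vs) t = inst ws (inst vs t)"
proof (induction vs arbitrary: ws t)
  case (Cons v vs)
  show ?case
  proof (cases t)
    case (Cons a t)
    have "inst ws (subst_var v a @ inst vs t) =
        inst (take (length v) ws @ drop (length v) ws) (subst_var v a @ inst vs t)"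
      by simp
    also have "\<dots> = inst (take (length v) ws) (subst_var v a) @ inst (drop (length v) ws) (inst vs t)"
      using Cons.prems by (intro inst_append_same) (simp add: subst_var_def)
    also have "inst (take (length v) ws) (subst_var v a) = inst ws (subst_var v a)"
      using Cons.prems inst_append_short[of "subst_var v a" "take (length v) ws" "drop (length v) ws"]
      by (simp add: subst_var_def)
    finally show ?thesis
      using Cons.prems Cons Cons.IH[of "drop (length v) ws" t] by (simp add: subst_var_comp_word)
  qed simp
qed (simp add: inst_def)

text \<open>As \<open>v\<close> starts with the variable, the composite starts with the first word
  of \<open>ws\<close> unevaluated, and that word starts with the variable.\<close>

lemma left_var_comp_word:
  assumes "\<forall>u\<in>set ws. left_var_word k u" "left_var_word k v" "ws \<noteq> []"
  shows "left_var_word k (comp_word ws v)"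
proof -
  obtain u us where ws: "ws = u # us"
    using assms(3) by (cases ws) auto
  obtain v' where v: "v = None # v'"
    using assms(2) by (cases v) (auto simp: left_var_word_def)
  have *: "set (case c of None \<Rightarrow> x | Some a \<Rightarrow> map Some (subst_var x a)) \<subseteq> insert None (Some ` {1..k})"
    if "(x, c) \<in> set (zip us v')" for x c
  proof -
    have "x \<in> set us" "c \<in> set v'"
      using that by (auto dest: set_zip_leftD set_zip_rightD)
    then have x: "set x \<subseteq> insert None (Some ` {1..k})" and c: "c \<in> insert None (Some ` {1..k})"
      using assms(1,2) ws v unfolding left_var_word_def by auto
    show ?thesis
    proof (cases c)
      case (Some b)
      then have "subst_var x b \<in> words k"
        using c by (intro subst_var_in_words[OF x]) auto
      then show ?thesis
        by (auto simp: Some words_def subset_iff image_iff)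
    qed (use x in simp)
  qed
  have "set (comp_word us v') \<subseteq> insert None (Some ` {1..k})"
    unfolding comp_word_def set_concat set_map image_image
  proof (rule UN_least)
    fix p assume "p \<in> set (zip us v')"
    then show "set (case p of (x, c) \<Rightarrow> case c of None \<Rightarrow> x | Some a \<Rightarrow> map Some (subst_var x a))
        \<subseteq> insert None (Some ` {1..k})"
      using *[of "fst p" "snd p"] by (simp only: case_prod_unfold prod.collapse)
  qed
  then show ?thesis
    using left_var_word_append[of k u "comp_word us v'"] assms(1) by (simp add: ws v comp_word_def)
qed

lemma left_var_comp_words:
  assumes "\<forall>u\<in>set ws. left_var_word k u" "\<forall>v\<in>set vs. left_var_word k v"
    "length (concat vs) \<le> length ws"
  shows "\<forall>v\<in>set (comp_words ws vs). left_var_word k v"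
  using assms
proof (induction vs arbitrary: ws)
  case (Cons v vs)
  have "\<forall>u\<in>set (drop (length v) ws). left_var_word k u"
    using Cons.prems(1) by (auto dest: in_set_dropD)
  then have "\<forall>v\<in>set (comp_words (drop (length v) ws) vs). left_var_word k v"
    using Cons.prems by (intro Cons.IH) auto
  moreover have "ws \<noteq> []"
    using Cons.prems(2,3) by (auto simp: left_var_word_def)
  ultimately show ?case
    using Cons.prems left_var_comp_word by simp
qed simp

text \<open>The first composite word, evaluated at \<open>c\<close>, is absorbed into the root, and
  the other \<open>m\<close> words span the subtree. Its positions have length at most
  \<open>length (concat vs)\<close>, which keeps it inside the tree.\<close>

lemma cs_subtree:
  assumes "w \<in> words k" "\<forall>v\<in>set ws. left_var_word k v" "\<forall>v\<in>set vs. left_var_word k v"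
    "length vs = Suc m" "1 \<le> m" "length (concat vs) \<le> length ws" "c \<in> {1..k}"
  shows "cs_tree k m {w @ inst ws (inst vs (c # t)) | t. t \<in> words k \<and> length t \<le> m}"
    and "{w @ inst ws (inst vs (c # t)) | t. t \<in> words k \<and> length t \<le> m} \<subseteq> cs_set k w ws"
proof -
  obtain v us where C: "comp_words ws vs = v # us"
    using assms(4) by (metis length_Suc_conv length_comp_words)
  have us: "length us = m"
    using assms(4) C by (metis length_comp_words length_Cons nat.inject)
  have lv: "left_var_word k v" "\<forall>u\<in>set us. left_var_word k u"
    using left_var_comp_words[OF assms(2,3,6)] C by auto
  let ?w = "w @ subst_var v c"
  have "?w \<in> words k"
    using subst_var_in_words[of v k c] lv(1) assms(1,7) by (auto simp: words_def left_var_word_def)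
  moreover have "w @ inst ws (inst vs (c # t)) = ?w @ inst us t" for t
    using inst_comp_words[OF assms(6), of "c # t"] C by simp
  then have "{w @ inst ws (inst vs (c # t)) | t. t \<in> words k \<and> length t \<le> m} = cs_set k ?w us"
    unfolding cs_set_eq us by simp
  ultimately show "cs_tree k m {w @ inst ws (inst vs (c # t)) | t. t \<in> words k \<and> length t \<le> m}"
    unfolding cs_tree_def using assms(5) us lv(2) by blast
  have len: "length (inst vs t) \<le> length (concat vs)" for t
  proof (induction vs arbitrary: t)
    case (Cons v vs)
    then show ?case
      by (cases t) (auto simp: subst_var_def)
  qed (simp add: inst_def)
  have "inst vs (c # t) \<in> words k \<and> length (inst vs (c # t)) \<le> length ws" if "t \<in> words k" for t
    using inst_in_words[OF assms(3), of "c # t"] that assms(7) len[of "c # t"] assms(6)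
    by (auto simp: words_def)
  then show "{w @ inst ws (inst vs (c # t)) | t. t \<in> words k \<and> length t \<le> m} \<subseteq> cs_set k w ws"
    unfolding cs_set_eq by blast
qed

subsection \<open>Correlated events\<close>

text \<open>Let X be the number of events that occur. Its mean is at least
  \<open>N * \<epsilon>\<close>, while its second moment sums the measures of pairwise intersections
  and would be at most \<open>N + N\<^sup>2 * \<theta>\<^sup>2\<close> if no pair were
  correlated.\<close>

lemma (in prob_space) correlated_pair:
  assumes A: "\<And>i. i < N \<Longrightarrow> A i \<in> events" "\<And>i. i < N \<Longrightarrow> \<epsilon> \<le> prob (A i)"
    and "0 \<le> \<epsilon>" "1 < real N * (\<epsilon>\<^sup>2 - \<theta>\<^sup>2)"
  shows "\<exists>j<N. \<exists>i<j. \<theta>\<^sup>2 \<le> prob (A i \<inter> A j)"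
proof (rule ccontr)
  assume "\<not> ?thesis"
  then have small: "prob (A i \<inter> A j) \<le> \<theta>\<^sup>2" if "i < j" "j < N" for i j
    using that by force
  let ?X = "\<lambda>x. \<Sum>i<N. indicator (A i) x :: real"
  have X2: "(?X x)\<^sup>2 = (\<Sum>i<N. \<Sum>j<N. indicator (A i \<inter> A j) x)" for x
    by (simp add: power2_eq_square sum_product indicator_inter_arith)
  have int: "integrable M (\<lambda>x. indicator (A i) x :: real)"
    "integrable M (\<lambda>x. indicator (A i \<inter> A j) x :: real)" if "i < N" "j < N" for i j
    using A(1)[OF that(1)] A(1)[OF that(2)] by (auto simp: less_top[symmetric] emeasure_eq_measure)
  have EX: "expectation ?X = (\<Sum>i<N. prob (A i))"
    using int A(1) by (subst Bochner_Integration.integral_sum) auto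
  have EX2: "expectation (\<lambda>x. (?X x)\<^sup>2) = (\<Sum>i<N. \<Sum>j<N. prob (A i \<inter> A j))"
  proof -
    have "expectation (\<lambda>x. (?X x)\<^sup>2) = (\<Sum>i<N. expectation (\<lambda>x. \<Sum>j<N. indicator (A i \<inter> A j) x))"
      unfolding X2 by (rule Bochner_Integration.integral_sum, rule Bochner_Integration.integrable_sum)
        (auto intro: int)
    also have "\<dots> = (\<Sum>i<N. \<Sum>j<N. expectation (indicator (A i \<inter> A j)))"
      by (intro sum.cong refl Bochner_Integration.integral_sum) (auto intro: int)
    finally show ?thesis
      using A(1) by (simp add: sets.Int sets.sets_into_space Int_absorb2 le_infI1)
  qed
  \<comment> \<open>Nonnegativity of the variance serves as the Cauchy-Schwarz inequality.\<close>
  have "0 \<le> variance ?X"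
    by (rule variance_positive)
  also have "variance ?X = expectation (\<lambda>x. (?X x)\<^sup>2) - (expectation ?X)\<^sup>2"
    by (rule variance_eq) (unfold X2, intro Bochner_Integration.integrable_sum int, auto intro!: int)
  finally have "(\<Sum>i<N. prob (A i))\<^sup>2 \<le> (\<Sum>i<N. \<Sum>j<N. prob (A i \<inter> A j))"
    by (simp add: EX EX2)
  \<comment> \<open>Each of the \<open>N\<close> diagonal terms costs at most an extra 1.\<close>
  also have "\<dots> \<le> (\<Sum>i<N. \<Sum>j<N. (if i = j then 1 else 0) + \<theta>\<^sup>2)"
  proof (intro sum_mono)
    fix i j assume "i \<in> {..<N}" "j \<in> {..<N}"
    then show "prob (A i \<inter> A j) \<le> (if i = j then 1 else 0) + \<theta>\<^sup>2"
      using small[of i j] small[of j i] measure_le_1[of "A i"]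
      by (cases i j rule: linorder_cases) (auto simp: Int_commute add_increasing2)
  qed
  also have "\<dots> = real N + (real N)\<^sup>2 * \<theta>\<^sup>2"
    by (simp add: sum.distrib power2_eq_square algebra_simps)
  finally have "(\<Sum>i<N. prob (A i))\<^sup>2 \<le> real N + (real N)\<^sup>2 * \<theta>\<^sup>2" .
  moreover have "real N * \<epsilon> \<le> (\<Sum>i<N. prob (A i))"
    using sum_mono[of "{..<N}" "\<lambda>_. \<epsilon>" "\<lambda>i. prob (A i)"] A(2) by simp
  then have "(real N * \<epsilon>)\<^sup>2 \<le> (\<Sum>i<N. prob (A i))\<^sup>2"
    using assms(3) by (intro power_mono) auto
  ultimately have "real N * (real N * (\<epsilon>\<^sup>2 - \<theta>\<^sup>2)) \<le> real N * 1"
    by (simp add: power_mult_distrib power2_eq_square algebra_simps)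
  moreover have "0 < N"
    using assms(4) by (cases N) auto
  ultimately show False
    using assms(4) by (simp add: mult_le_cancel_left)
qed

section \<open>Compactness, and transfer between probability spaces\<close>

lemma finite_cs_set: "finite (cs_set k w ws)"
proof -
  have "cs_set k w ws = (\<lambda>s. w @ inst ws s) ` {s \<in> words k. length s \<le> length ws}"
    unfolding cs_set_eq by blast
  then show ?thesis
    by (simp add: finite_words_le)
qed

text \<open>Counterexamples of unbounded dimension would define, along a nonprincipal ultrafilter,
  one graph on all words, taken as positions. It has no independent sequence of length
  \<open>N\<close>, so it contains a clique tree, and some counterexample is deep enough to contain
  the image of that tree.\<close>

lemma threshold_exists:
  fixes k m :: nat and \<theta> \<epsilon> :: real
  assumes "1 \<le> k" "1 \<le> m" "0 < \<theta>" "\<theta> < \<epsilon>"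
  shows "\<exists>N :: nat. \<forall>d W (M :: 'a measure) A. cs_tree k d W \<longrightarrow> N \<le> d \<longrightarrow> prob_space M \<longrightarrow>
    (\<forall>w\<in>W. A w \<in> sets M \<and> measure M (A w) \<ge> \<epsilon>) \<longrightarrow>
    (\<exists>U. cs_tree k m U \<and> U \<subseteq> W \<and> (\<forall>u\<in>U. \<forall>u'\<in>U. measure M (A u \<inter> A u') \<ge> \<theta>\<^sup>2))"
proof -
  define good where "good W M A \<longleftrightarrow> (\<exists>U. cs_tree k m U \<and> U \<subseteq> W \<and>
      (\<forall>u\<in>U. \<forall>u'\<in>U. measure M (A u \<inter> A u') \<ge> \<theta>\<^sup>2))" for W and M :: "'a measure" and A
  have "\<exists>N :: nat. \<forall>d W (M :: 'a measure) A. cs_tree k d W \<longrightarrow> N \<le> d \<longrightarrow> prob_space M \<longrightarrow>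
    (\<forall>w\<in>W. A w \<in> sets M \<and> measure M (A w) \<ge> \<epsilon>) \<longrightarrow> good W M A"
  proof (rule ccontr)
    assume "\<not> ?thesis"
    then have "\<forall>n. \<exists>d W M A. cs_tree k d W \<and> n \<le> d \<and> prob_space M \<and>
        (\<forall>w\<in>W. A w \<in> sets M \<and> measure M (A w) \<ge> \<epsilon>) \<and> \<not> good W M A"
      by blast
    then obtain d W and M :: "nat \<Rightarrow> 'a measure" and A where
      tree: "\<And>n. cs_tree k (d n) (W n)" and d: "\<And>n. n \<le> d n" and M: "\<And>n. prob_space (M n)"
      and A: "\<And>n w. w \<in> W n \<Longrightarrow> A n w \<in> sets (M n) \<and> measure (M n) (A n w) \<ge> \<epsilon>"
      and bad: "\<And>n. \<not> good (W n) (M n) (A n)"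
      by metis
    have "\<forall>n. \<exists>w ws. w \<in> words k \<and> length ws = d n \<and> (\<forall>v\<in>set ws. left_var_word k v) \<and> W n = cs_set k w ws"
      using tree unfolding cs_tree_def by blast
    then obtain w ws where w: "\<And>n. w n \<in> words k" and ws: "\<And>n. length (ws n) = d n"
      "\<And>n. \<forall>v\<in>set (ws n). left_var_word k v" and W: "\<And>n. W n = cs_set k (w n) (ws n)"
      by metis
    obtain \<U> :: "nat filter" where \<U>: "ultra \<U>" "\<U> \<le> sequentially"
      using ultra_exists[of sequentially] by auto
    have bot: "\<U> \<noteq> bot" using \<U>(1) by (simp add: ultra_def)
    have large: "eventually (\<lambda>n. l \<le> d n) \<U>" for l
      by (rule filter_leD[OF \<U>(2)], rule eventually_mono[OF eventually_ge_at_top[of l]])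
         (use d order_trans in blast)
    \<comment> \<open>Indexing events by positions gives all trees the common index set
      \<open>words k\<close>; at stage \<open>n\<close> the positions of length at most
      \<open>d n\<close> are nodes.\<close>
    define B where "B n s = A n (w n @ inst (ws n) s)" for n s
    have B: "B n s \<in> sets (M n) \<and> \<epsilon> \<le> measure (M n) (B n s)" if "s \<in> words k" "length s \<le> d n" for n s
      unfolding B_def by (rule A) (use that ws in \<open>auto simp: W cs_set_eq\<close>)
    define R where "R s s' \<longleftrightarrow> eventually (\<lambda>n. \<theta>\<^sup>2 \<le> measure (M n) (B n s \<inter> B n s')) \<U>" for s s'
    have "0 < \<epsilon>\<^sup>2 - \<theta>\<^sup>2"
      using assms(3,4) by (simp add: power_strict_mono)
    then obtain N where N: "1 < real N * (\<epsilon>\<^sup>2 - \<theta>\<^sup>2)"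
      using reals_Archimedean3 by blast
    have ind: "\<exists>j<N. \<exists>i<j. R (s i) (s j)" if s: "\<And>i. i < N \<Longrightarrow> s i \<in> words k" for s
    proof (rule ccontr)
      assume "\<not> (\<exists>j<N. \<exists>i<j. R (s i) (s j))"
      then have "eventually (\<lambda>n. \<not> \<theta>\<^sup>2 \<le> measure (M n) (B n (s i) \<inter> B n (s j))) \<U>" if "i < j" "j < N" for i j
        using that unfolding R_def ultra_not_iff[OF \<U>(1)] by blast
      then have "eventually (\<lambda>n. \<forall>j\<in>{..<N}. \<forall>i\<in>{..<j}. \<not> \<theta>\<^sup>2 \<le> measure (M n) (B n (s i) \<inter> B n (s j))) \<U>"
        by (intro eventually_ball_finite ballI) auto
      moreover have "eventually (\<lambda>n. \<forall>i\<in>{..<N}. length (s i) \<le> d n) \<U>"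
        by (intro eventually_ball_finite ballI large) auto
      ultimately obtain n where n: "\<forall>j\<in>{..<N}. \<forall>i\<in>{..<j}. \<not> \<theta>\<^sup>2 \<le> measure (M n) (B n (s i) \<inter> B n (s j))"
        "\<forall>i\<in>{..<N}. length (s i) \<le> d n"
        using eventually_happens'[OF bot eventually_conj] by blast
      interpret prob_space "M n" by (rule M)
      have "\<exists>j<N. \<exists>i<j. \<theta>\<^sup>2 \<le> measure (M n) (B n (s i) \<inter> B n (s j))"
        by (rule correlated_pair[OF _ _ _ N]) (use B s n(2) assms in auto)
      then show False
        using n(1) by blast
    qed
    have one: "1 \<in> {1..k}"
      using assms(1) by simp
    have sym: "symp R"
      by (auto simp: symp_def R_def Int_commute)
    obtain vs where vs: "length vs = Suc m" "\<forall>v\<in>set vs. left_var_word k v"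
      "\<forall>t\<in>{t \<in> words k. length t \<le> m}. \<forall>t'\<in>{t \<in> words k. length t \<le> m}.
         R (inst vs (1 # t)) (inst vs (1 # t'))"
      using related_tree[OF ind sym one, of m] by blast
    let ?T = "{t \<in> words k. length t \<le> m}"
    have "eventually (\<lambda>n. \<forall>t\<in>?T. \<forall>t'\<in>?T.
        \<theta>\<^sup>2 \<le> measure (M n) (B n (inst vs (1 # t)) \<inter> B n (inst vs (1 # t')))) \<U>"
      using vs(3) unfolding R_def by (intro eventually_ball_finite ballI finite_words_le) auto
    \<comment> \<open>One stage realizes the finitely many relations of the clique and has room for
      its longest positions.\<close>
    then obtain n where n: "\<forall>t\<in>?T. \<forall>t'\<in>?T.
        \<theta>\<^sup>2 \<le> measure (M n) (B n (inst vs (1 # t)) \<inter> B n (inst vs (1 # t')))"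
      and "length (concat vs) \<le> d n"
      using eventually_happens'[OF bot eventually_conj[OF _ large]] by blast
    then have len: "length (concat vs) \<le> length (ws n)"
      by (simp only: ws(1))
    let ?U = "{w n @ inst (ws n) (inst vs (1 # t)) | t. t \<in> words k \<and> length t \<le> m}"
    have "cs_tree k m ?U" "?U \<subseteq> W n"
      unfolding W using cs_subtree[OF w ws(2) vs(2,1) assms(2) len one] by blast+
    moreover have "\<forall>u\<in>?U. \<forall>u'\<in>?U. \<theta>\<^sup>2 \<le> measure (M n) (A n u \<inter> A n u')"
      using n unfolding B_def by blast
    ultimately show False
      using bad unfolding good_def by blast
  qed
  then show ?thesis
    unfolding good_def .
qed

text \<open>Finitely many events matter only through the pattern of those containing a given point.
  The new measure is the distribution of this pattern, coded as a natural number.\<close>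

lemma prob_space_to_nat:
  assumes "prob_space M" "finite W" "\<And>w. w \<in> W \<Longrightarrow> A w \<in> sets M"
  obtains M' :: "nat measure" and A' where "prob_space M'" "\<And>w. A' w \<in> sets M'"
    "\<And>u u'. u \<in> W \<Longrightarrow> u' \<in> W \<Longrightarrow> measure M' (A' u \<inter> A' u') = measure M (A u \<inter> A u')"
proof -
  interpret prob_space M by fact
  define e where "e = to_nat_on (Pow W)"
  have e: "inj_on e (Pow W)"
    unfolding e_def using assms(2) by (intro inj_on_to_nat_on countable_finite) simp
  define f where "f x = e {w \<in> W. x \<in> A w}" for x
  define A' where "A' w = e ` {S \<in> Pow W. w \<in> S}" for w
  have "(\<lambda>x. {w \<in> W. x \<in> A w}) \<in> measurable M (count_space (Pow W))"
  proof -
    have "(\<lambda>x. {w \<in> W. x \<in> A w}) -` {S} \<inter> space M \<in> sets M" if "S \<in> Pow W" for S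
    proof -
      have "(\<lambda>x. {w \<in> W. x \<in> A w}) -` {S} \<inter> space M = {x \<in> space M. \<forall>w\<in>W. x \<in> A w \<longleftrightarrow> w \<in> S}"
        using that by auto
      also have "\<dots> \<in> sets M"
      proof (rule sets.sets_Collect_finite_All[OF _ assms(2)])
        fix w assume w: "w \<in> W"
        have "{x \<in> space M. x \<in> A w \<longleftrightarrow> w \<in> S} = (if w \<in> S then A w else space M - A w)"
          using sets.sets_into_space[OF assms(3)[OF w]] by auto
        then show "{x \<in> space M. x \<in> A w \<longleftrightarrow> w \<in> S} \<in> sets M"
          using assms(3)[OF w] by auto
      qed
      finally show ?thesis .
    qed
    then show ?thesis
      using assms(2) by (subst measurable_count_space_eq2) auto
  qed
  then have "(\<lambda>x. e {w \<in> W. x \<in> A w}) \<in> measurable M (count_space UNIV)"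
    by (rule measurable_compose) simp
  then have f: "f \<in> measurable M (count_space UNIV)"
    by (simp add: f_def[abs_def])
  have vim: "f -` (A' u \<inter> A' u') \<inter> space M = A u \<inter> A u'" if "u \<in> W" "u' \<in> W" for u u'
  proof -
    have "f x \<in> A' w \<longleftrightarrow> x \<in> A w" if "w \<in> W" for x w
      unfolding f_def A'_def using that by (subst inj_on_image_mem_iff[OF e]) auto
    then show ?thesis
      using that assms(3)[THEN sets.sets_into_space] by auto
  qed
  show ?thesis
  proof (rule that[of "distr M (count_space UNIV) f" A'])
    show "prob_space (distr M (count_space UNIV) f)"
      using f by (rule prob_space_distr)
    show "measure (distr M (count_space UNIV) f) (A' u \<inter> A' u') = measure M (A u \<inter> A u')"
      if "u \<in> W" "u' \<in> W" for u u'
      using vim[OF that] by (simp add: measure_distr[OF f])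
  qed simp
qed

text \<open>\<open>Cor2\<close> speaks of measures on \<open>nat\<close>; a general space is
  replaced by one on \<open>nat\<close> with the same pairwise measures over the finite set
  \<open>W\<close>.\<close>

theorem proposition10p1:
  fixes k m :: nat and \<theta> \<epsilon> :: real
  assumes "2 \<le> k" and "1 \<le> m" and "0 < \<theta>" and "\<theta> < \<epsilon>" and "\<epsilon> \<le> 1"
  shows "0 < Cor2 k m \<theta> \<epsilon> \<and>
    (\<forall>d W (M :: 'a measure) (A :: nat list \<Rightarrow> 'a set).
       cs_tree k d W \<longrightarrow> Cor2 k m \<theta> \<epsilon> \<le> d \<longrightarrow> prob_space M \<longrightarrow>
       (\<forall>w\<in>W. A w \<in> sets M \<and> measure M (A w) \<ge> \<epsilon>) \<longrightarrow>
       (\<exists>U. cs_tree k m U \<and> U \<subseteq> W \<and>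
          (\<forall>u\<in>U. \<forall>u'\<in>U. measure M (A u \<inter> A u') \<ge> \<theta>\<^sup>2)))"
proof -
  define P where "P N \<longleftrightarrow> 0 < N \<and> (\<forall>d W (M :: nat measure) A.
        cs_tree k d W \<longrightarrow> N \<le> d \<longrightarrow> prob_space M \<longrightarrow>
        (\<forall>w\<in>W. A w \<in> sets M \<and> measure M (A w) \<ge> \<epsilon>) \<longrightarrow>
        (\<exists>U. cs_tree k m U \<and> U \<subseteq> W \<and>
           (\<forall>u\<in>U. \<forall>u'\<in>U. measure M (A u \<inter> A u') \<ge> \<theta>\<^sup>2)))" for N
  have "1 \<le> k"
    using assms(1) by simp
  obtain N where N: "\<forall>d W (M :: nat measure) A. cs_tree k d W \<longrightarrow> N \<le> d \<longrightarrow> prob_space M \<longrightarrow>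
    (\<forall>w\<in>W. A w \<in> sets M \<and> measure M (A w) \<ge> \<epsilon>) \<longrightarrow>
    (\<exists>U. cs_tree k m U \<and> U \<subseteq> W \<and> (\<forall>u\<in>U. \<forall>u'\<in>U. measure M (A u \<inter> A u') \<ge> \<theta>\<^sup>2))"
    using threshold_exists[OF \<open>1 \<le> k\<close> assms(2-4)] ..
  have "P (Suc N)"
    unfolding P_def using N Suc_leD by blast
  then have Cor2: "P (Cor2 k m \<theta> \<epsilon>)"
    unfolding Cor2_def P_def[symmetric] by (rule LeastI)
  have "\<exists>U. cs_tree k m U \<and> U \<subseteq> W \<and> (\<forall>u\<in>U. \<forall>u'\<in>U. measure M (A u \<inter> A u') \<ge> \<theta>\<^sup>2)"
    if W: "cs_tree k d W" "Cor2 k m \<theta> \<epsilon> \<le> d" and M: "prob_space M"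
      and A: "\<forall>w\<in>W. A w \<in> sets M \<and> measure M (A w) \<ge> \<epsilon>"
    for d W and M :: "'a measure" and A
  proof -
    have "finite W"
      using W(1) finite_cs_set unfolding cs_tree_def by blast
    then obtain M' :: "nat measure" and A' where M': "prob_space M'" "\<And>w. A' w \<in> sets M'"
      "\<And>u u'. u \<in> W \<Longrightarrow> u' \<in> W \<Longrightarrow> measure M' (A' u \<inter> A' u') = measure M (A u \<inter> A u')"
      using prob_space_to_nat[OF M, of W A] A by blast
    \<comment> \<open>The pairs with \<open>u = u'\<close> give the measures of single
      events.\<close>
    have "\<forall>w\<in>W. A' w \<in> sets M' \<and> measure M' (A' w) \<ge> \<epsilon>"
      using A M'(2,3) by (metis Int_absorb)
    then obtain U where "cs_tree k m U" "U \<subseteq> W"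
      "\<forall>u\<in>U. \<forall>u'\<in>U. measure M' (A' u \<inter> A' u') \<ge> \<theta>\<^sup>2"
      using Cor2 W M'(1) unfolding P_def by blast
    then show ?thesis
      using M'(3) by (metis subsetD)
  qed
  then show ?thesis
    using Cor2 unfolding P_def by blast
qed

end
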